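(* Let $G$ be a connected $m$-uniform hypergraph on vertex set $[n]$, where $m$ is even. Then the number of even (resp. odd) bipartitions of $G$ equals the number of solutions $y\in\mathbb{Z}_2^n$ of $B_Gy=0$ (resp. $B_Gy=\mathbf{1}$) over $\mathbb{Z}_2$ with $y_1=0$, which equals the number of first Laplacian (resp. first signless Laplacian) H-eigenvectors of $G$. Moreover, the number of even bipartitions of $G$ is $1$ (corresponding to the trivial bipartition) or a power of $2$, and it equals the number of odd bipartitions of $G$ if $G$ has an odd bipartition.
   Context: An $m$-uniform hypergraph $G$ has edges that are $m$-element subsets of its vertex set $[n]$. For even $m$, an even (resp. odd) bipartition of $G$ is an unordered pair $\{V_1,V_2\}$ with $V_1\cup V_2=V(G)$, $V_1\cap V_2=\emptyset$, such that every edge meets $V_1$ (equivalently $V_2$) in an even (resp. odd) number of vertices; for even bipartitions the trivial case where one part is empty is allowed. Its adjacency tensor $\mathcal{A}(G)$ has entry $\frac{1}{(m-1)!}$ at $(i_1,\dots,i_m)$ if $\{i_1,\dots,i_m\}$ is an edge and $0$ otherwise; $\mathcal{D}(G)$ is the diagonal tensor of vertex degrees; $\mathcal{L}(G)=\mathcal{D}(G)-\mathcal{A}(G)$, $\mathcal{Q}(G)=\mathcal{D}(G)+\mathcal{A}(G)$. A first Laplacian (resp. signless Laplacian) eigenvector is a nonzero $x\in\mathbb{C}^n$ with $\sum_{i_2,\dots,i_m}\mathcal{T}_{ii_2\cdots i_m}x_{i_2}\cdots x_{i_m}=0$ for all $i$ where $\mathcal{T}=\mathcal{L}(G)$ (resp.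 $\mathcal{Q}(G)$), counted up to nonzero scalar; it is an H-eigenvector if it is a scalar multiple of a real vector. $B_G$ is the $|E(G)|\times n$ incidence matrix ($(e,v)$ entry $1$ iff $v\in e$, else $0$), and $\mathbf{1}$ is the all-ones vector. *)

theory Defs
  imports Complex_Main "HOL-Library.Z2" "HOL-Library.FuncSet"
begin

text \<open>A hypergraph on the vertex set \<open>{1..n}\<close> is given by its set \<open>E\<close> of edges.\<close>

definition uniform_hypergraph :: "nat \<Rightarrow> nat \<Rightarrow> nat set set \<Rightarrow> bool" where
  "uniform_hypergraph m n E \<longleftrightarrow> (\<forall>e\<in>E. e \<subseteq> {1..n} \<and> card e = m)"

definition connected_hypergraph :: "nat \<Rightarrow> nat set set \<Rightarrow> bool" where
  "connected_hypergraph n E \<longleftrightarrow>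
     (\<forall>u\<in>{1..n}. \<forall>v\<in>{1..n}. (u, v) \<in> {(a, b). \<exists>e\<in>E. a \<in> e \<and> b \<in> e}\<^sup>*)"

text \<open>
  The unordered pair of parts is the set \<open>{V1, V2}\<close>. Empty parts are not excluded in either
  definition; as soon as there is an edge, an odd bipartition has two nonempty parts when the
  uniformity is even. For even uniformity the parity conditions for \<open>V1\<close> and \<open>V2\<close> agree.
\<close>

definition even_bipartitions :: "nat \<Rightarrow> nat set set \<Rightarrow> nat set set set" where
  "even_bipartitions n E =
     {{V1, V2} | V1 V2. V1 \<union> V2 = {1..n} \<and> V1 \<inter> V2 = {} \<and> (\<forall>e\<in>E. even (card (e \<inter> V1)))}"

definition odd_bipartitions :: "nat \<Rightarrow> nat set set \<Rightarrow> nat set set set" where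
  "odd_bipartitions n E =
     {{V1, V2} | V1 V2. V1 \<union> V2 = {1..n} \<and> V1 \<inter> V2 = {} \<and> (\<forall>e\<in>E. odd (card (e \<inter> V1)))}"

text \<open>The rows of the incidence matrix are indexed by the edges themselves.\<close>

definition incidence_matrix :: "nat set \<Rightarrow> nat \<Rightarrow> bit" where
  "incidence_matrix e v = (if v \<in> e then 1 else 0)"

definition incidence_solutions ::
    "nat \<Rightarrow> nat set set \<Rightarrow> (nat set \<Rightarrow> bit) \<Rightarrow> (nat \<Rightarrow> bit) set" where
  "incidence_solutions n E b =
     {y \<in> {1..n} \<rightarrow>\<^sub>E UNIV. \<forall>e\<in>E. (\<Sum>v\<in>{1..n}. incidence_matrix e v * y v) = b e}"

text \<open>
  A tensor of order \<open>m\<close> and dimension \<open>n\<close> maps index lists of length \<open>m\<close> over \<open>{1..n}\<close> to its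
  entries; values at other lists are irrelevant.
\<close>

type_synonym tensor = "nat list \<Rightarrow> complex"

definition degree :: "nat set set \<Rightarrow> nat \<Rightarrow> nat" where
  "degree E v = card {e \<in> E. v \<in> e}"

definition adjacency_tensor :: "nat \<Rightarrow> nat set set \<Rightarrow> tensor" where
  "adjacency_tensor m E is = (if set is \<in> E then 1 / fact (m - 1) else 0)"

definition degree_tensor :: "nat \<Rightarrow> nat set set \<Rightarrow> tensor" where
  "degree_tensor m E is = (if is = replicate m (hd is) then of_nat (degree E (hd is)) else 0)"

definition laplacian_tensor :: "nat \<Rightarrow> nat set set \<Rightarrow> tensor" where
  "laplacian_tensor m E is = degree_tensor m E is - adjacency_tensor m E is"

definition signless_laplacian_tensor :: "nat \<Rightarrow> nat set set \<Rightarrow> tensor" where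
  "signless_laplacian_tensor m E is = degree_tensor m E is + adjacency_tensor m E is"

definition tensor_apply :: "nat \<Rightarrow> nat \<Rightarrow> tensor \<Rightarrow> (nat \<Rightarrow> complex) \<Rightarrow> nat \<Rightarrow> complex" where
  "tensor_apply m n T x i =
     (\<Sum>is\<in>{is. set is \<subseteq> {1..n} \<and> length is = m - 1}. T (i # is) * prod_list (map x is))"

definition first_eigenvectors :: "nat \<Rightarrow> nat \<Rightarrow> tensor \<Rightarrow> (nat \<Rightarrow> complex) set" where
  "first_eigenvectors m n T =
     {x \<in> {1..n} \<rightarrow>\<^sub>E UNIV. (\<exists>i\<in>{1..n}. x i \<noteq> 0) \<and> (\<forall>i\<in>{1..n}. tensor_apply m n T x i = 0)}"

definition first_H_eigenvectors :: "nat \<Rightarrow> nat \<Rightarrow> tensor \<Rightarrow> (nat \<Rightarrow> complex) set" where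
  "first_H_eigenvectors m n T =
     {x \<in> first_eigenvectors m n T.
        \<exists>(c::complex) (r::nat \<Rightarrow> real). \<forall>i\<in>{1..n}. x i = c * complex_of_real (r i)}"

definition scalar_multiple_rel :: "nat \<Rightarrow> ((nat \<Rightarrow> complex) \<times> (nat \<Rightarrow> complex)) set" where
  "scalar_multiple_rel n =
     {(x, y). x \<in> {1..n} \<rightarrow>\<^sub>E UNIV \<and> y \<in> {1..n} \<rightarrow>\<^sub>E UNIV \<and>
        (\<exists>c. c \<noteq> 0 \<and> (\<forall>i\<in>{1..n}. y i = c * x i))}"

text \<open>
  H-eigenvectors up to a nonzero complex scalar. The first H-eigenvectors are closed under
  nonzero scaling, so these classes consist of H-eigenvectors only.
\<close>

definition first_H_eigenvector_classes :: "nat \<Rightarrow> nat \<Rightarrow> tensor \<Rightarrow> (nat \<Rightarrow> complex) set set" where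
  "first_H_eigenvector_classes m n T = first_H_eigenvectors m n T // scalar_multiple_rel n"

end

theory Submission
  imports Defs "HOL-Combinatorics.Multiset_Permutations"
begin

text \<open>
  Everything is parametrised by the vertex sets \<open>V\<close> that avoid vertex 1 and meet every edge in an
  even (odd) number of vertices: \<open>V\<close> is a part of a bipartition, the support of a solution of the
  incidence system, and the negative set of a sign vector. By a maximum modulus argument all
  entries of a first eigenvector have the same modulus, so an H-eigenvector is a multiple of a sign
  vector, for which the eigenvalue equations reduce to the parity condition. Even sets form a
  group under symmetric difference, and the odd sets are empty or a coset of it.
\<close>

section \<open>Parity counts, sign products, and families closed under symmetric difference\<close>

lemma odd_card_sym_diff:
  assumes "finite A" "finite B"
  shows "odd (card (sym_diff A B)) \<longleftrightarrow> odd (card A) \<noteq> odd (card B)"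
proof -
  have "card (sym_diff A B) = card (A - B) + card (B - A)"
    using assms by (intro card_Un_disjoint) auto
  moreover have "card A = card (A - B) + card (A \<inter> B)" "card B = card (B - A) + card (A \<inter> B)"
    using card_Diff_subset_Int[of A B] card_Diff_subset_Int[of B A] assms
      card_mono[of A "A \<inter> B"] card_mono[of B "A \<inter> B"]
    by (auto simp: Int_commute)
  ultimately show ?thesis by auto
qed

text \<open>Such a family is a subspace of the power set of \<open>U\<close>, viewed as a vector
  space over the field with two elements. Adding a point \<open>a\<close> to the ground set either
  adds no member containing \<open>a\<close> or doubles the subfamily \<open>F0\<close> of members
  that avoid \<open>a\<close>.\<close>

lemma card_sym_diff_closed_power2:
  assumes "finite U" "F \<subseteq> Pow U" "F \<noteq> {}" "\<And>A B. A \<in> F \<Longrightarrow> B \<in> F \<Longrightarrow> sym_diff A B \<in> F"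
  shows "\<exists>k. card F = 2 ^ k"
  using assms
proof (induction U arbitrary: F rule: finite_induct)
  case empty
  then have "F = {{}}" by auto
  then show ?case by (intro exI[of _ 0]) simp
next
  case (insert a U)
  define F0 where "F0 = {V \<in> F. a \<notin> V}"
  obtain V where V: "V \<in> F" using insert.prems(2) by auto
  \<comment> \<open>The zero element makes \<open>F0\<close> nonempty, as the induction hypothesis
    requires.\<close>
  have "{} \<in> F" using insert.prems(3)[OF V V] by simp
  then have "\<exists>k. card F0 = 2 ^ k"
    using insert.prems by (intro insert.IH) (auto simp: F0_def)
  then obtain k where k: "card F0 = 2 ^ k" by blast
  show ?case
  proof (cases "F = F0")
    case False
    then obtain W where W: "W \<in> F" "a \<in> W" by (auto simp: F0_def)
    \<comment> \<open>Translation by \<open>W\<close> is its own inverse, and since \<open>a\<close>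
      lies in \<open>W\<close> it exchanges the members with and without \<open>a\<close>.\<close>
    have "bij_betw (sym_diff W) F0 (F - F0)"
      by (rule bij_betw_byWitness[where f' = "sym_diff W"])
        (use W insert.prems(3) in \<open>auto simp: F0_def\<close>)
    then have "card (F - F0) = card F0" by (simp add: bij_betw_same_card)
    moreover have fin: "finite F"
      using insert.prems(1) insert.hyps(1) finite_subset by fastforce
    have "card F = card F0 + card (F - F0)"
      using fin card_Un_disjoint[of F0 "F - F0"] by (auto simp: F0_def Un_absorb1 intro!: arg_cong[of _ _ card])
    ultimately have "card F = 2 ^ Suc k" using k by simp
    then show ?thesis by blast
  qed (use k in auto)
qed

lemma sum_bit_eq_odd_card:
  fixes y :: "'a \<Rightarrow> bit"
  assumes "finite A"
  shows "sum y A = of_bool (odd (card {v \<in> A. y v = 1}))"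
  using assms
proof (induction A rule: finite_induct)
  case (insert a A)
  have "{v \<in> insert a A. y v = 1} = (if y a = 1 then insert a {v \<in> A. y v = 1} else {v \<in> A. y v = 1})"
    by auto
  then show ?case using insert by (cases "y a") auto
qed simp

lemma prod_sign_eq:
  assumes "finite A"
  shows "(\<Prod>v\<in>A. if v \<in> V then -1 else (1::'a::comm_ring_1)) = (if odd (card (A \<inter> V)) then -1 else 1)"
proof -
  have "(\<Prod>v\<in>A. if v \<in> V then -1 else (1::'a)) = (-1) ^ card (A \<inter> V)"
    using assms by (simp add: prod.If_cases)
  then show ?thesis by simp
qed

text \<open>Equality case of the bound of a product by the power of \<open>M\<close>: a single
  factor below \<open>M\<close> makes the bound strict, because \<open>M\<close> is positive. The
  maximum modulus argument applies this to the moduli on one edge.\<close>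

lemma prod_eq_power_imp_eq:
  fixes f :: "'a \<Rightarrow> real"
  assumes "finite A" "\<And>j. j \<in> A \<Longrightarrow> 0 \<le> f j \<and> f j \<le> M" "0 < M"
    "prod f A = M ^ card A" "j \<in> A"
  shows "f j = M"
proof (rule ccontr)
  assume "f j \<noteq> M"
  then have less: "f j < M" using assms(2,5) by fastforce
  have "prod f A = f j * prod f (A - {j})"
    using assms(1,5) by (simp add: prod.remove)
  also have "\<dots> \<le> f j * M ^ card (A - {j})"
    using assms(2,5) prod_mono[of "A - {j}" f "\<lambda>_. M"] by (intro mult_left_mono) auto
  also have "\<dots> < M * M ^ card (A - {j})"
    using less assms(3) by simp
  also have "\<dots> = M ^ card A"
    using assms(1,5) by (metis card.remove power_Suc)
  finally show False using assms(4) by simp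
qed

section \<open>Parity sets as a group and its coset\<close>

locale even_uniform_connected_hypergraph =
  fixes m n :: nat and E :: "nat set set"
  assumes n_ge_1: "n \<ge> 1" and m_ge_2: "m \<ge> 2" and even_m: "even m"
    and uniform: "uniform_hypergraph m n E"
    and connected: "connected_hypergraph n E"
begin

lemma edge_subset: "e \<in> E \<Longrightarrow> e \<subseteq> {1..n}"
  and card_edge: "e \<in> E \<Longrightarrow> card e = m"
  using uniform by (auto simp: uniform_hypergraph_def)

lemma finite_edge: "e \<in> E \<Longrightarrow> finite e"
  using edge_subset finite_subset by blast

lemma finite_edges: "finite E"
  using edge_subset finite_subset[of E "Pow {1..n}"] by blast

lemma edge_nonempty: "e \<in> E \<Longrightarrow> e \<noteq> {}"
  using card_edge m_ge_2 by force

text \<open>The Boolean \<open>p\<close> treats the even case (\<open>False\<close>) and the odd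
  case (\<open>True\<close>) in one argument. Avoiding vertex 1 picks one part of each unordered
  pair; it matches \<open>y 1 = 0\<close> for solutions and the value 1 at vertex 1 for sign
  vectors.\<close>

definition parity_sets :: "bool \<Rightarrow> nat set set" where
  "parity_sets p = {V. V \<subseteq> {1..n} \<and> 1 \<notin> V \<and> (\<forall>e\<in>E. odd (card (e \<inter> V)) \<longleftrightarrow> p)}"

lemma finite_parity_sets: "finite (parity_sets p)"
  by (rule finite_subset[of _ "Pow {1..n}"]) (auto simp: parity_sets_def)

text \<open>Intersecting with an edge commutes with symmetric difference, so parities add modulo 2.
  Hence the even sets form a group, and translation by an odd set exchanges even and odd
  sets.\<close>

lemma sym_diff_parity_sets:
  assumes "V \<in> parity_sets p" "W \<in> parity_sets q"
  shows "sym_diff V W \<in> parity_sets (p \<noteq> q)"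
proof -
  have "odd (card (e \<inter> sym_diff V W)) \<longleftrightarrow> p \<noteq> q" if "e \<in> E" for e
  proof -
    have "e \<inter> sym_diff V W = sym_diff (e \<inter> V) (e \<inter> W)" by blast
    then show ?thesis
      using assms that odd_card_sym_diff[of "e \<inter> V" "e \<inter> W"] finite_edge[OF that]
      by (auto simp: parity_sets_def)
  qed
  then show ?thesis using assms by (auto simp: parity_sets_def)
qed

lemma empty_parity_set: "{} \<in> parity_sets False"
  by (auto simp: parity_sets_def)

lemma card_parity_sets_False: "\<exists>k. card (parity_sets False) = 2 ^ k"
  using empty_parity_set sym_diff_parity_sets[of _ False _ False]
  by (intro card_sym_diff_closed_power2[of "{1..n}"]) (auto simp: parity_sets_def)

lemma card_parity_sets_True:
  assumes "parity_sets True \<noteq> {}"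
  shows "card (parity_sets False) = card (parity_sets True)"
proof -
  obtain W where W: "W \<in> parity_sets True" using assms by blast
  have "bij_betw (sym_diff W) (parity_sets False) (parity_sets True)"
    using sym_diff_parity_sets[OF W, of _ False] sym_diff_parity_sets[OF W, of _ True]
    by (intro bij_betw_byWitness[where f' = "sym_diff W"]) auto
  then show ?thesis by (rule bij_betw_same_card)
qed

section \<open>Bipartitions\<close>

definition parity_bipartitions :: "bool \<Rightarrow> nat set set set" where
  "parity_bipartitions p = {{V1, V2} | V1 V2. V1 \<union> V2 = {1..n} \<and> V1 \<inter> V2 = {} \<and>
     (\<forall>e\<in>E. odd (card (e \<inter> V1)) \<longleftrightarrow> p)}"

lemma parity_bipartitions_simps:
  "even_bipartitions n E = parity_bipartitions False"
  "odd_bipartitions n E = parity_bipartitions True"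
  by (simp_all add: even_bipartitions_def odd_bipartitions_def parity_bipartitions_def)

text \<open>The two intersection sizes add up to the even number \<open>m\<close>.\<close>

lemma odd_card_complement:
  assumes "e \<in> E" "V1 \<union> V2 = {1..n}" "V1 \<inter> V2 = {}"
  shows "odd (card (e \<inter> V1)) \<longleftrightarrow> odd (card (e \<inter> V2))"
proof -
  have "e = (e \<inter> V1) \<union> (e \<inter> V2)" using edge_subset[OF assms(1)] assms(2) by blast
  moreover have "card ((e \<inter> V1) \<union> (e \<inter> V2)) = card (e \<inter> V1) + card (e \<inter> V2)"
    using finite_edge[OF assms(1)] assms(3) by (intro card_Un_disjoint) auto
  ultimately show ?thesis using card_edge[OF assms(1)] even_m by (metis even_add)
qed

text \<open>Exactly one part of a bipartition misses vertex 1, and by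
  \<open>odd_card_complement\<close> the parity condition may be read off from either part.\<close>

lemma bij_betw_parity_bipartitions:
  "bij_betw (\<lambda>V. {V, {1..n} - V}) (parity_sets p) (parity_bipartitions p)"
proof (rule bij_betw_imageI)
  show "inj_on (\<lambda>V. {V, {1..n} - V}) (parity_sets p)"
  proof (rule inj_onI)
    fix V W assume VW: "V \<in> parity_sets p" "W \<in> parity_sets p"
      and "{V, {1..n} - V} = {W, {1..n} - W}"
    then have "V = W \<or> V = {1..n} - W" unfolding doubleton_eq_iff by blast
    moreover have "1 \<in> {1..n} - W" "1 \<notin> V" using VW n_ge_1 by (auto simp: parity_sets_def)
    ultimately show "V = W" by blast
  qed
  show "(\<lambda>V. {V, {1..n} - V}) ` parity_sets p = parity_bipartitions p"
  proof (intro equalityI subsetI)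
    fix P assume "P \<in> (\<lambda>V. {V, {1..n} - V}) ` parity_sets p"
    then obtain V where "V \<in> parity_sets p" and P: "P = {V, {1..n} - V}" by blast
    then have "V \<union> ({1..n} - V) = {1..n}" "V \<inter> ({1..n} - V) = {}"
      "\<forall>e\<in>E. odd (card (e \<inter> V)) \<longleftrightarrow> p"
      unfolding parity_sets_def by blast+
    with P show "P \<in> parity_bipartitions p" unfolding parity_bipartitions_def by blast
  next
    fix P assume "P \<in> parity_bipartitions p"
    then obtain V1 V2 where P: "P = {V1, V2}" and V: "V1 \<union> V2 = {1..n}" "V1 \<inter> V2 = {}"
      and par: "\<forall>e\<in>E. odd (card (e \<inter> V1)) \<longleftrightarrow> p"
      unfolding parity_bipartitions_def by blast
    have par2: "\<forall>e\<in>E. odd (card (e \<inter> V2)) \<longleftrightarrow> p"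
      using par odd_card_complement[OF _ V] by blast
    have eqs: "V2 = {1..n} - V1" "V1 = {1..n} - V2" using V by blast+
    show "P \<in> (\<lambda>V. {V, {1..n} - V}) ` parity_sets p"
    proof (cases "1 \<in> V1")
      case True
      then have "V2 \<in> parity_sets p" using V par2 unfolding parity_sets_def by blast
      moreover have "P = {V2, {1..n} - V2}" unfolding P eqs(2)[symmetric] by (rule insert_commute)
      ultimately show ?thesis by (rule rev_image_eqI)
    next
      case False
      then have "V1 \<in> parity_sets p" using V par unfolding parity_sets_def by blast
      moreover have "P = {V1, {1..n} - V1}" unfolding P eqs(1)[symmetric] ..
      ultimately show ?thesis by (rule rev_image_eqI)
    qed
  qed
qed

section \<open>Solutions of the incidence system over the field with two elements\<close>

lemma incidence_row_sum:
  assumes "e \<in> E"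
  shows "(\<Sum>v\<in>{1..n}. incidence_matrix e v * y v) = of_bool (odd (card (e \<inter> {v \<in> {1..n}. y v = 1})))"
proof -
  have "(\<Sum>v\<in>{1..n}. incidence_matrix e v * y v) = (\<Sum>v\<in>e. y v)"
    using edge_subset[OF assms]
    by (intro sum.mono_neutral_cong_right) (auto simp: incidence_matrix_def)
  moreover have "{v \<in> e. y v = 1} = e \<inter> {v \<in> {1..n}. y v = 1}" using edge_subset[OF assms] by auto
  ultimately show ?thesis by (simp add: sum_bit_eq_odd_card[OF finite_edge[OF assms]])
qed

lemma incidence_solutions_iff:
  "y \<in> incidence_solutions n E (\<lambda>e. of_bool p) \<longleftrightarrow>
     y \<in> {1..n} \<rightarrow>\<^sub>E UNIV \<and> (\<forall>e\<in>E. odd (card (e \<inter> {v \<in> {1..n}. y v = 1})) \<longleftrightarrow> p)"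
proof -
  have "(\<Sum>v\<in>{1..n}. incidence_matrix e v * y v) = of_bool p \<longleftrightarrow>
      (odd (card (e \<inter> {v \<in> {1..n}. y v = 1})) \<longleftrightarrow> p)" if "e \<in> E" for e
    unfolding incidence_row_sum[OF that] by (rule of_bool_eq_iff)
  then show ?thesis unfolding incidence_solutions_def mem_Collect_eq by blast
qed

text \<open>Support and indicator vector are mutually inverse. The indicator is restricted to
  \<open>{1..n}\<close> because solutions are extensional, that is, \<open>undefined\<close> at all
  other arguments.\<close>

lemma bij_betw_incidence_solutions:
  "bij_betw (\<lambda>y. {v \<in> {1..n}. y v = 1})
     {y \<in> incidence_solutions n E (\<lambda>e. of_bool p). y 1 = 0} (parity_sets p)"
proof (rule bij_betw_byWitness[where f' = "\<lambda>V. \<lambda>v\<in>{1..n}. of_bool (v \<in> V)"])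
  let ?S = "{y \<in> incidence_solutions n E (\<lambda>e. of_bool p). y 1 = 0}"
  show "\<forall>y\<in>?S. (\<lambda>v\<in>{1..n}. of_bool (v \<in> {v \<in> {1..n}. y v = 1})) = y"
    by (fastforce simp: incidence_solutions_iff fun_eq_iff PiE_def extensional_def)
  show "\<forall>V\<in>parity_sets p. {v \<in> {1..n}. (\<lambda>v\<in>{1..n}. of_bool (v \<in> V)) v = (1::bit)} = V"
    by (auto simp: parity_sets_def)
  show "(\<lambda>y. {v \<in> {1..n}. y v = 1}) ` ?S \<subseteq> parity_sets p"
    by (auto simp: incidence_solutions_iff parity_sets_def)
  show "(\<lambda>V. \<lambda>v\<in>{1..n}. of_bool (v \<in> V)) ` parity_sets p \<subseteq> ?S"
  proof clarify
    fix V assume V: "V \<in> parity_sets p"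
    have "{v \<in> {1..n}. (\<lambda>v\<in>{1..n}. of_bool (v \<in> V)) v = (1::bit)} = V"
      using V by (auto simp: parity_sets_def)
    then show "(\<lambda>v\<in>{1..n}. of_bool (v \<in> V)) \<in> incidence_solutions n E (\<lambda>e. of_bool p) \<and>
        (\<lambda>v\<in>{1..n}. of_bool (v \<in> V)) 1 = (0::bit)"
      using V n_ge_1 by (auto simp: incidence_solutions_iff parity_sets_def)
  qed
qed

section \<open>Action of the Laplacian tensors\<close>

text \<open>The sign is tied to the parity: even sets belong to the Laplacian, odd sets to the
  signless Laplacian.\<close>

definition parity_tensor :: "bool \<Rightarrow> tensor" where
  "parity_tensor p is = degree_tensor m E is + (if p then 1 else -1) * adjacency_tensor m E is"

lemma parity_tensor_simps:
  "laplacian_tensor m E = parity_tensor False"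
  "signless_laplacian_tensor m E = parity_tensor True"
  by (auto simp: fun_eq_iff laplacian_tensor_def signless_laplacian_tensor_def parity_tensor_def)

lemma tensor_apply_degree:
  assumes "i \<in> {1..n}"
  shows "tensor_apply m n (degree_tensor m E) x i = of_nat (degree E i) * x i ^ (m - 1)"
proof -
  have *: "i # is = replicate m i \<longleftrightarrow> is = replicate (m - 1) i" for "is"
    using m_ge_2 by (cases m) auto
  have fin: "finite {is. set is \<subseteq> {1..n} \<and> length is = m - 1}"
    by (rule finite_lists_length_eq) simp
  have "tensor_apply m n (degree_tensor m E) x i =
      (\<Sum>is\<in>{is. set is \<subseteq> {1..n} \<and> length is = m - 1}.
        if is = replicate (m - 1) i then of_nat (degree E i) * prod_list (map x is) else 0)"
    unfolding tensor_apply_def degree_tensor_def list.sel * by (intro sum.cong) auto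
  also have "\<dots> = of_nat (degree E i) * prod_list (map x (replicate (m - 1) i))"
    using fin assms by (subst sum.delta) auto
  finally show ?thesis by (simp add: prod_list_replicate)
qed

text \<open>The \<open>m - 1\<close> entries have to cover the \<open>m - 1\<close> vertices of
  \<open>e\<close> other than \<open>i\<close>, which leaves room neither for a repetition nor for
  \<open>i\<close> itself.\<close>

lemma lists_completing_edge:
  assumes "e \<in> E" "i \<in> e"
  shows "{is. set is \<subseteq> {1..n} \<and> length is = m - 1 \<and> insert i (set is) = e} = permutations_of_set (e - {i})"
proof (intro equalityI subsetI)
  fix "is" assume "is \<in> {is. set is \<subseteq> {1..n} \<and> length is = m - 1 \<and> insert i (set is) = e}"
  then have is_: "length is = m - 1" "insert i (set is) = e" by auto
  \<comment> \<open>Since \<open>card (set is)\<close> is at most \<open>m - 1\<close>, the summand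
    must be 1 and the list must have no repeated entry.\<close>
  have "m \<le> card (set is) + (if i \<in> set is then 0 else 1)"
    using card_edge[OF assms(1)] is_(2) by (auto simp: card_insert_if split: if_splits)
  with card_length[of "is"] is_(1) m_ge_2 have "i \<notin> set is" "card (set is) = length is"
    by (auto split: if_splits)
  then show "is \<in> permutations_of_set (e - {i})"
    using is_(2) by (auto simp: permutations_of_set_def card_distinct)
next
  fix "is" assume "is \<in> permutations_of_set (e - {i})"
  then have is_: "set is = e - {i}" "distinct is" by (auto simp: permutations_of_set_def)
  then have "length is = m - 1"
    using assms card_edge[OF assms(1)] finite_edge[OF assms(1)] distinct_card[of "is"] by simp
  then show "is \<in> {is. set is \<subseteq> {1..n} \<and> length is = m - 1 \<and> insert i (set is) = e}"
    using is_(1) assms edge_subset[OF assms(1)] by auto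
qed

text \<open>The index lists are grouped by the edge \<open>insert i (set is)\<close>. Each edge is
  reached by the \<open>fact (m - 1)\<close> orderings of its other vertices, which cancels the
  normalisation of the tensor.\<close>

lemma tensor_apply_adjacency:
  "tensor_apply m n (adjacency_tensor m E) x i = (\<Sum>e\<in>{e \<in> E. i \<in> e}. \<Prod>j\<in>e - {i}. x j)"
proof -
  let ?L = "{is. set is \<subseteq> {1..n} \<and> length is = m - 1}"
  let ?P = "\<lambda>e. {is. set is \<subseteq> {1..n} \<and> length is = m - 1 \<and> insert i (set is) = e}"
  have fin: "finite ?L" by (rule finite_lists_length_eq) simp
  have "tensor_apply m n (adjacency_tensor m E) x i =
      (\<Sum>is\<in>{is \<in> ?L. insert i (set is) \<in> {e \<in> E. i \<in> e}}. prod_list (map x is) / fact (m - 1))"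
    unfolding tensor_apply_def adjacency_tensor_def
    by (rule sum.mono_neutral_cong_right[OF fin]) auto
  also have "\<dots> = (\<Sum>e\<in>{e \<in> E. i \<in> e}. \<Sum>is\<in>?P e. prod_list (map x is) / fact (m - 1))"
  proof -
    have "{is \<in> ?L. insert i (set is) \<in> {e \<in> E. i \<in> e}} = (\<Union>e\<in>{e \<in> E. i \<in> e}. ?P e)" by auto
    moreover have "finite (?P e)" for e using fin by (rule rev_finite_subset) auto
    ultimately show ?thesis
      using finite_edges by (simp only:) (intro sum.UNION_disjoint; auto)
  qed
  also have "\<dots> = (\<Sum>e\<in>{e \<in> E. i \<in> e}. \<Prod>j\<in>e - {i}. x j)"
  proof (rule sum.cong[OF refl])
    fix e assume "e \<in> {e \<in> E. i \<in> e}"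
    then have e: "e \<in> E" "i \<in> e" by auto
    have "(\<Sum>is\<in>?P e. prod_list (map x is) / fact (m - 1)) =
        (\<Sum>is\<in>permutations_of_set (e - {i}). (\<Prod>j\<in>e - {i}. x j) / fact (m - 1))"
      unfolding lists_completing_edge[OF e]
      by (intro sum.cong) (auto simp: permutations_of_set_def prod.distinct_set_conv_list[symmetric])
    also have "\<dots> = (\<Prod>j\<in>e - {i}. x j)"
      using e card_edge finite_edge by (simp add: card_permutations_of_set)
    finally show "(\<Sum>is\<in>?P e. prod_list (map x is) / fact (m - 1)) = (\<Prod>j\<in>e - {i}. x j)" .
  qed
  finally show ?thesis .
qed

lemma tensor_apply_parity:
  assumes "i \<in> {1..n}"
  shows "tensor_apply m n (parity_tensor p) x i =
    of_nat (degree E i) * x i ^ (m - 1) +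
    (if p then 1 else -1) * (\<Sum>e\<in>{e \<in> E. i \<in> e}. \<Prod>j\<in>e - {i}. x j)"
proof -
  have "tensor_apply m n (parity_tensor p) x i =
    tensor_apply m n (degree_tensor m E) x i + (if p then 1 else -1) * tensor_apply m n (adjacency_tensor m E) x i"
    unfolding tensor_apply_def parity_tensor_def
    by (simp add: sum.distrib sum_distrib_left algebra_simps sum_subtractf)
  then show ?thesis by (simp add: tensor_apply_degree[OF assms] tensor_apply_adjacency)
qed

lemma tensor_apply_cong:
  assumes "\<And>j. j \<in> {1..n} \<Longrightarrow> x j = y j"
  shows "tensor_apply m n T x i = tensor_apply m n T y i"
  unfolding tensor_apply_def using assms
  by (intro sum.cong refl arg_cong2[of _ _ _ _ "(*)"] arg_cong[of _ _ prod_list] map_cong) auto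

section \<open>Constant modulus of first eigenvectors\<close>

text \<open>
  Where the modulus is maximal, the eigenvalue equation forces equality in the triangle
  inequality, so the modulus is maximal on every incident edge; connectivity does the rest.
\<close>

lemma norm_first_eigenvector:
  assumes x: "x \<in> first_eigenvectors m n (parity_tensor p)" and "i \<in> {1..n}" "j \<in> {1..n}"
  shows "norm (x i) = norm (x j)"
proof -
  define M where "M = Max ((\<lambda>i. norm (x i)) ` {1..n})"
  have le_M: "norm (x i) \<le> M" if "i \<in> {1..n}" for i
    unfolding M_def using that by (intro Max_ge) auto
  have "M \<in> (\<lambda>i. norm (x i)) ` {1..n}"
    unfolding M_def using n_ge_1 by (intro Max_in) auto
  then obtain u where u: "u \<in> {1..n}" "norm (x u) = M" by auto
  obtain w where "w \<in> {1..n}" "x w \<noteq> 0" using x by (auto simp: first_eigenvectors_def)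
  with le_M[of w] have M_pos: "M > 0" by (meson less_le_trans zero_less_norm_iff)
  have spread: "norm (x b) = M" if a: "norm (x a) = M" and e: "e \<in> E" "a \<in> e" "b \<in> e" for a b e
  proof (cases "a = b")
    case False
    have a_in: "a \<in> {1..n}" using e edge_subset by blast
    let ?f = "\<lambda>e. \<Prod>j\<in>e - {a}. norm (x j)" and ?Ea = "{e \<in> E. a \<in> e}"
    have f_le: "?f e \<le> M ^ (m - 1)" if "e \<in> ?Ea" for e
    proof -
      have "?f e \<le> (\<Prod>j\<in>e - {a}. M)"
        using that edge_subset[of e] le_M by (intro prod_mono) auto
      then show ?thesis using that card_edge finite_edge by simp
    qed
    have "tensor_apply m n (parity_tensor p) x a = 0"
      using x a_in by (auto simp: first_eigenvectors_def)
    then have "norm (of_nat (degree E a) * x a ^ (m - 1)) = norm (\<Sum>e\<in>?Ea. \<Prod>j\<in>e - {a}. x j)"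
      unfolding tensor_apply_parity[OF a_in]
      by (cases p) (auto simp: add_eq_0_iff2)
    \<comment> \<open>The degree is the number of edges in \<open>?Ea\<close>, so the diagonal term
      becomes a sum over the same edges. With \<open>f_le\<close> each termwise difference is
      nonnegative, hence zero.\<close>
    then have "(\<Sum>e\<in>?Ea. M ^ (m - 1)) \<le> (\<Sum>e\<in>?Ea. ?f e)"
      using norm_sum[of "\<lambda>e. \<Prod>j\<in>e - {a}. x j" ?Ea] a
      by (simp add: degree_def norm_mult norm_power prod_norm)
    then have "(\<Sum>e\<in>?Ea. M ^ (m - 1) - ?f e) \<le> 0" by (simp add: sum_subtractf)
    moreover have "(\<Sum>e\<in>?Ea. M ^ (m - 1) - ?f e) \<ge> 0" using f_le by (intro sum_nonneg) simp
    ultimately have "(\<Sum>e\<in>?Ea. M ^ (m - 1) - ?f e) = 0" by linarith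
    then have "\<forall>e\<in>?Ea. M ^ (m - 1) - ?f e = 0"
      using f_le finite_edges by (subst (asm) sum_nonneg_eq_0_iff) auto
    then have "?f e = M ^ (m - 1)" using e by auto
    moreover have "card (e - {a}) = m - 1" using e card_edge finite_edge by simp
    ultimately show ?thesis
      using e False le_M edge_subset[OF e(1)] finite_edge[OF e(1)] M_pos
      by (intro prod_eq_power_imp_eq[of "e - {a}" "\<lambda>j. norm (x j)" M b]) auto
  qed (use a in simp)
  have "norm (x v) = M" if "v \<in> {1..n}" for v
  proof -
    have "(u, v) \<in> {(a, b). \<exists>e\<in>E. a \<in> e \<and> b \<in> e}\<^sup>*"
      using connected u(1) that by (auto simp: connected_hypergraph_def)
    then show ?thesis
      by (induction rule: rtrancl_induct) (use u spread in auto)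
  qed
  then show ?thesis using assms by simp
qed

section \<open>Sign vectors as representatives of H-eigenvectors\<close>

definition sign_vector :: "nat set \<Rightarrow> nat \<Rightarrow> complex" where
  "sign_vector V = (\<lambda>i\<in>{1..n}. if i \<in> V then -1 else 1)"

text \<open>
  For even \<open>m\<close> the value \<open>\<plusminus>1\<close> of \<open>s i\<close> equals \<open>s i ^ (m - 1)\<close> and its own inverse, so a
  common factor can be pulled out of the eigenvalue equation at \<open>i\<close>, leaving a sum of terms
  each of which is \<open>0\<close> or \<open>2\<close>.
\<close>

lemma tensor_apply_sign_vector:
  assumes "i \<in> {1..n}"
  shows "tensor_apply m n (parity_tensor p) (\<lambda>j. c * sign_vector V j) i =
    c ^ (m - 1) * sign_vector V i * of_nat (2 * card {e \<in> E. i \<in> e \<and> odd (card (e \<inter> V)) \<noteq> p})"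
proof -
  let ?Ei = "{e \<in> E. i \<in> e}" and ?s = "sign_vector V" and ?\<sigma> = "if p then 1 else -1 :: complex"
  have s: "?s i = 1 \<or> ?s i = -1" using assms by (auto simp: sign_vector_def)
  have "odd (m - 1)" using even_m m_ge_2 by simp
  with s have pow: "?s i ^ (m - 1) = ?s i" by auto
  have edge_prod: "(\<Prod>j\<in>e - {i}. c * ?s j) = c ^ (m - 1) * ?s i * (if odd (card (e \<inter> V)) then -1 else 1)"
    if "e \<in> ?Ei" for e
  proof -
    from that have e: "e \<in> E" "i \<in> e" by auto
    have "?s i * prod ?s (e - {i}) = prod ?s e"
      using prod.remove[OF finite_edge[OF e(1)] e(2), of ?s] by simp
    also have "\<dots> = (\<Prod>j\<in>e. if j \<in> V then -1 else 1)"
      using edge_subset[OF e(1)] by (intro prod.cong) (auto simp: sign_vector_def)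
    also have "\<dots> = (if odd (card (e \<inter> V)) then -1 else 1)"
      by (rule prod_sign_eq[OF finite_edge[OF e(1)]])
    finally have *: "?s i * prod ?s (e - {i}) = (if odd (card (e \<inter> V)) then -1 else 1)" .
    have "prod ?s (e - {i}) = ?s i * (?s i * prod ?s (e - {i}))" using s by auto
    then have "prod ?s (e - {i}) = ?s i * (if odd (card (e \<inter> V)) then -1 else 1)"
      unfolding * .
    then show ?thesis
      using e card_edge finite_edge by (simp add: prod.distrib)
  qed
  have "tensor_apply m n (parity_tensor p) (\<lambda>j. c * ?s j) i =
      of_nat (degree E i) * (c ^ (m - 1) * ?s i) +
      ?\<sigma> * (\<Sum>e\<in>?Ei. c ^ (m - 1) * ?s i * (if odd (card (e \<inter> V)) then -1 else 1))"
    unfolding tensor_apply_parity[OF assms] power_mult_distrib pow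
    using sum.cong[OF refl edge_prod, of ?Ei "\<lambda>e. e"] by (simp cong: sum.cong)
  also have "\<dots> = c ^ (m - 1) * ?s i * (\<Sum>e\<in>?Ei. 1 + ?\<sigma> * (if odd (card (e \<inter> V)) then -1 else 1))"
    by (simp add: degree_def sum.distrib sum_distrib_left[symmetric] algebra_simps sum_subtractf)
  \<comment> \<open>The edges of the wrong parity contribute 2 each, all others cancel.\<close>
  also have "(\<Sum>e\<in>?Ei. 1 + ?\<sigma> * (if odd (card (e \<inter> V)) then -1 else 1)) =
      (\<Sum>e\<in>{e \<in> E. i \<in> e \<and> odd (card (e \<inter> V)) \<noteq> p}. 2)"
    using finite_edges by (intro sum.mono_neutral_cong_right) auto
  finally show ?thesis by simp
qed

text \<open>The equation at \<open>i\<close> has as its left-hand side a nonzero multiple of the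
  number of edges through \<open>i\<close> with the wrong parity. As edges are nonempty, every edge
  is tested at one of its vertices.\<close>

lemma sign_vector_eigen_iff:
  assumes "c \<noteq> 0" "V \<subseteq> {1..n}" "1 \<notin> V"
  shows "(\<forall>i\<in>{1..n}. tensor_apply m n (parity_tensor p) (\<lambda>j. c * sign_vector V j) i = 0)
    \<longleftrightarrow> V \<in> parity_sets p"
proof -
  have "tensor_apply m n (parity_tensor p) (\<lambda>j. c * sign_vector V j) i = 0 \<longleftrightarrow>
      (\<forall>e\<in>E. i \<in> e \<longrightarrow> (odd (card (e \<inter> V)) \<longleftrightarrow> p))" if i: "i \<in> {1..n}" for i
  proof -
    have "sign_vector V i \<noteq> 0" using i by (simp add: sign_vector_def)
    moreover have "finite {e \<in> E. i \<in> e \<and> odd (card (e \<inter> V)) \<noteq> p}" using finite_edges by simp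
    ultimately show ?thesis
      unfolding tensor_apply_sign_vector[OF i] using assms(1) by (auto simp: card_eq_0_iff)
  qed
  then have "(\<forall>i\<in>{1..n}. tensor_apply m n (parity_tensor p) (\<lambda>j. c * sign_vector V j) i = 0)
    \<longleftrightarrow> (\<forall>e\<in>E. \<forall>i\<in>e. odd (card (e \<inter> V)) \<longleftrightarrow> p)"
    using edge_subset by blast
  also have "\<dots> \<longleftrightarrow> V \<in> parity_sets p"
    using edge_nonempty assms(2,3) by (auto simp: parity_sets_def)
  finally show ?thesis .
qed

lemma sign_vector_1: "1 \<notin> V \<Longrightarrow> sign_vector V 1 = 1"
  using n_ge_1 by (simp add: sign_vector_def)

lemma sign_vector_first_H_eigenvector:
  assumes V: "V \<in> parity_sets p"
  shows "sign_vector V \<in> first_H_eigenvectors m n (parity_tensor p)"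
proof -
  have "\<forall>i\<in>{1..n}. tensor_apply m n (parity_tensor p) (sign_vector V) i = 0"
    using sign_vector_eigen_iff[of 1 V p] V by (simp add: parity_sets_def)
  moreover have "sign_vector V i = 1 * complex_of_real (if i \<in> V then -1 else 1)" if "i \<in> {1..n}" for i
    using that by (simp add: sign_vector_def)
  then have "\<exists>c r. \<forall>i\<in>{1..n}. sign_vector V i = c * complex_of_real (r i)"
    by (intro exI[of _ 1] exI[of _ "\<lambda>i. if i \<in> V then -1 else 1"]) blast
  moreover have "\<exists>i\<in>{1..n}. sign_vector V i \<noteq> 0"
    using sign_vector_1[of V] V n_ge_1 by (intro bexI[of _ 1]) (auto simp: parity_sets_def)
  moreover have "sign_vector V \<in> {1..n} \<rightarrow>\<^sub>E UNIV" by (simp add: sign_vector_def)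
  ultimately show ?thesis by (simp add: first_H_eigenvectors_def first_eigenvectors_def)
qed

text \<open>Real numbers of equal absolute value differ only by sign, so constant modulus leaves
  just the two values \<open>x 1\<close> and \<open>- x 1\<close>.\<close>

lemma first_H_eigenvector_sign_vector:
  assumes x: "x \<in> first_H_eigenvectors m n (parity_tensor p)"
  obtains V c where "V \<in> parity_sets p" "c \<noteq> 0" "\<And>i. i \<in> {1..n} \<Longrightarrow> x i = c * sign_vector V i"
proof -
  have ev: "x \<in> first_eigenvectors m n (parity_tensor p)"
    using x by (simp add: first_H_eigenvectors_def)
  obtain c r where r: "\<And>i. i \<in> {1..n} \<Longrightarrow> x i = c * complex_of_real (r i)"
    using x by (auto simp: first_H_eigenvectors_def)
  have one: "1 \<in> {1..n}" using n_ge_1 by simp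
  obtain w where w: "w \<in> {1..n}" "x w \<noteq> 0" using ev by (auto simp: first_eigenvectors_def)
  have "x 1 \<noteq> 0" using norm_first_eigenvector[OF ev one w(1)] w(2) by auto
  then have "c \<noteq> 0" using r[OF one] by auto
  \<comment> \<open>Comparison with \<open>x 1\<close> keeps vertex 1 out of \<open>V\<close>; the
    scalar in front of the sign vector is then \<open>x 1\<close>, not the factor \<open>c\<close>
    of the real vector.\<close>
  define V where "V = {i \<in> {1..n}. x i \<noteq> x 1}"
  have x_eq: "x i = x 1 * sign_vector V i" if i: "i \<in> {1..n}" for i
  proof -
    have "norm c * \<bar>r i\<bar> = norm c * \<bar>r 1\<bar>"
      using norm_first_eigenvector[OF ev i one] r[OF i] r[OF one] by (simp add: norm_mult)
    then have "r i = r 1 \<or> r i = - r 1" using \<open>c \<noteq> 0\<close> by (auto simp: abs_eq_iff)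
    then have "x i = x 1 \<or> x i = - x 1" using r[OF i] r[OF one] by auto
    then show ?thesis using i by (auto simp: sign_vector_def V_def)
  qed
  have "\<forall>i\<in>{1..n}. tensor_apply m n (parity_tensor p) (\<lambda>j. x 1 * sign_vector V j) i = 0"
    using ev tensor_apply_cong[OF x_eq] by (auto simp: first_eigenvectors_def)
  then have "V \<in> parity_sets p"
    using sign_vector_eigen_iff[OF \<open>x 1 \<noteq> 0\<close>, of V p] unfolding V_def by blast
  then show thesis using that \<open>x 1 \<noteq> 0\<close> x_eq by blast
qed

section \<open>Eigenvector classes up to scalars\<close>

lemma equiv_scalar_multiple_rel: "equiv ({1..n} \<rightarrow>\<^sub>E UNIV) (scalar_multiple_rel n)"
proof (rule equivI)
  show "scalar_multiple_rel n \<subseteq> ({1..n} \<rightarrow>\<^sub>E UNIV) \<times> ({1..n} \<rightarrow>\<^sub>E UNIV)"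
    by (auto simp: scalar_multiple_rel_def)
  show "refl_on ({1..n} \<rightarrow>\<^sub>E UNIV) (scalar_multiple_rel n)"
    by (auto simp: refl_on_def scalar_multiple_rel_def intro: exI[of _ 1])
  show "sym (scalar_multiple_rel n)"
  proof (rule symI)
    fix x y assume "(x, y) \<in> scalar_multiple_rel n"
    then obtain c where "x \<in> {1..n} \<rightarrow>\<^sub>E UNIV" "y \<in> {1..n} \<rightarrow>\<^sub>E UNIV" "c \<noteq> 0"
      "\<forall>i\<in>{1..n}. y i = c * x i"
      by (auto simp: scalar_multiple_rel_def)
    then show "(y, x) \<in> scalar_multiple_rel n"
      by (auto simp: scalar_multiple_rel_def intro!: exI[of _ "inverse c"])
  qed
  show "trans (scalar_multiple_rel n)"
  proof (rule transI)
    fix x y z assume "(x, y) \<in> scalar_multiple_rel n" "(y, z) \<in> scalar_multiple_rel n"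
    then obtain c d where "x \<in> {1..n} \<rightarrow>\<^sub>E UNIV" "z \<in> {1..n} \<rightarrow>\<^sub>E UNIV" "c \<noteq> 0" "d \<noteq> 0"
      "\<forall>i\<in>{1..n}. y i = c * x i" "\<forall>i\<in>{1..n}. z i = d * y i"
      by (auto simp: scalar_multiple_rel_def)
    then show "(x, z) \<in> scalar_multiple_rel n"
      by (auto simp: scalar_multiple_rel_def intro!: exI[of _ "d * c"])
  qed
qed

text \<open>Every class contains a sign vector with value 1 at vertex 1, and only one: evaluation at
  vertex 1 forces the scalar between two of them to be 1.\<close>

lemma bij_betw_first_H_eigenvector_classes:
  "bij_betw (\<lambda>V. scalar_multiple_rel n `` {sign_vector V}) (parity_sets p)
     (first_H_eigenvector_classes m n (parity_tensor p))"
proof (rule bij_betw_imageI)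
  have ext: "sign_vector V \<in> {1..n} \<rightarrow>\<^sub>E UNIV" for V by (simp add: sign_vector_def)
  show "inj_on (\<lambda>V. scalar_multiple_rel n `` {sign_vector V}) (parity_sets p)"
  proof (rule inj_onI)
    fix V W assume VW: "V \<in> parity_sets p" "W \<in> parity_sets p"
      and eq: "scalar_multiple_rel n `` {sign_vector V} = scalar_multiple_rel n `` {sign_vector W}"
    from eq_equiv_class[OF eq equiv_scalar_multiple_rel ext] obtain c where
      c: "\<forall>i\<in>{1..n}. sign_vector W i = c * sign_vector V i"
      by (auto simp: scalar_multiple_rel_def)
    have "c = 1" using c sign_vector_1[of V] sign_vector_1[of W] VW n_ge_1
      by (auto simp: parity_sets_def)
    with c have "\<forall>i\<in>{1..n}. i \<in> V \<longleftrightarrow> i \<in> W"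
      by (auto simp: sign_vector_def split: if_splits)
    then show "V = W" using VW by (auto simp: parity_sets_def)
  qed
  show "(\<lambda>V. scalar_multiple_rel n `` {sign_vector V}) ` parity_sets p =
      first_H_eigenvector_classes m n (parity_tensor p)"
  proof (intro equalityI subsetI)
    fix C assume "C \<in> (\<lambda>V. scalar_multiple_rel n `` {sign_vector V}) ` parity_sets p"
    then show "C \<in> first_H_eigenvector_classes m n (parity_tensor p)"
      by (auto simp: first_H_eigenvector_classes_def intro: quotientI sign_vector_first_H_eigenvector)
  next
    fix C assume "C \<in> first_H_eigenvector_classes m n (parity_tensor p)"
    then obtain x where x: "x \<in> first_H_eigenvectors m n (parity_tensor p)"
      and C: "C = scalar_multiple_rel n `` {x}"
      by (auto simp: first_H_eigenvector_classes_def elim: quotientE)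
    obtain V c where V: "V \<in> parity_sets p" "c \<noteq> 0" "\<And>i. i \<in> {1..n} \<Longrightarrow> x i = c * sign_vector V i"
      using first_H_eigenvector_sign_vector[OF x] by blast
    have "x \<in> {1..n} \<rightarrow>\<^sub>E UNIV"
      using x by (simp add: first_H_eigenvectors_def first_eigenvectors_def)
    with V ext have "(sign_vector V, x) \<in> scalar_multiple_rel n"
      by (auto simp: scalar_multiple_rel_def)
    then have "C = scalar_multiple_rel n `` {sign_vector V}"
      unfolding C by (rule equiv_class_eq[OF equiv_scalar_multiple_rel, symmetric])
    with V(1) show "C \<in> (\<lambda>V. scalar_multiple_rel n `` {sign_vector V}) ` parity_sets p" by blast
  qed
qed

section \<open>Combining the counts\<close>

lemma card_parity_bipartitions: "card (parity_bipartitions p) = card (parity_sets p)"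
  using bij_betw_same_card[OF bij_betw_parity_bipartitions] by simp

lemma even_bipartitions_trivial_or_power2:
  "parity_bipartitions False = {{{}, {1..n}}} \<or> (\<exists>k\<ge>1. card (parity_bipartitions False) = 2 ^ k)"
proof -
  obtain k where k: "card (parity_bipartitions False) = 2 ^ k"
    using card_parity_sets_False card_parity_bipartitions by auto
  \<comment> \<open>The trivial bipartition is the image of the empty parity set; for exponent 0 it
    is therefore the only one.\<close>
  have triv: "{{}, {1..n}} \<in> parity_bipartitions False"
    using bij_betwE[OF bij_betw_parity_bipartitions, of False] empty_parity_set by fastforce
  show ?thesis
  proof (cases "k = 0")
    case True
    then obtain P where "parity_bipartitions False = {P}" using k by (auto simp: card_1_singleton_iff)
    then show ?thesis using triv by auto
  next
    case False
    then show ?thesis using k by (intro disjI2 exI[of _ k]) simp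
  qed
qed

end

text \<open>\<open>card\<close> is 0 on infinite sets, so an equality of cardinalities with value 0
  would not by itself exclude infinitely many classes; the finiteness conjuncts do.\<close>

theorem theorem4p7:
  fixes m n :: nat and E :: "nat set set"
  assumes "n \<ge> 1" and "m \<ge> 2" and "even m"
    and "uniform_hypergraph m n E"
    and "connected_hypergraph n E"
  shows "card (even_bipartitions n E) = card {y \<in> incidence_solutions n E (\<lambda>e. 0). y 1 = 0}
    \<and> finite (first_H_eigenvector_classes m n (laplacian_tensor m E))
    \<and> card {y \<in> incidence_solutions n E (\<lambda>e. 0). y 1 = 0}
        = card (first_H_eigenvector_classes m n (laplacian_tensor m E))
    \<and> card (odd_bipartitions n E) = card {y \<in> incidence_solutions n E (\<lambda>e. 1). y 1 = 0}
    \<and> finite (first_H_eigenvector_classes m n (signless_laplacian_tensor m E))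
    \<and> card {y \<in> incidence_solutions n E (\<lambda>e. 1). y 1 = 0}
        = card (first_H_eigenvector_classes m n (signless_laplacian_tensor m E))
    \<and> (even_bipartitions n E = {{{}, {1..n}}} \<or> (\<exists>k\<ge>1. card (even_bipartitions n E) = 2 ^ k))
    \<and> (odd_bipartitions n E \<noteq> {} \<longrightarrow>
         card (even_bipartitions n E) = card (odd_bipartitions n E))"
proof -
  interpret even_uniform_connected_hypergraph m n E
    using assms by unfold_locales
  \<comment> \<open>The right-hand sides 0 and 1 are \<open>of_bool False\<close> and
    \<open>of_bool True\<close>.\<close>
  have solutions: "card {y \<in> incidence_solutions n E (\<lambda>e. of_bool p). y 1 = 0} = card (parity_sets p)" for p
    by (rule bij_betw_same_card[OF bij_betw_incidence_solutions])
  have classes: "card (first_H_eigenvector_classes m n (parity_tensor p)) = card (parity_sets p)"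
    "finite (first_H_eigenvector_classes m n (parity_tensor p))" for p
    using bij_betw_same_card[OF bij_betw_first_H_eigenvector_classes, of p]
      bij_betw_finite[OF bij_betw_first_H_eigenvector_classes, of p] finite_parity_sets by auto
  have "parity_bipartitions True \<noteq> {} \<longrightarrow> parity_sets True \<noteq> {}"
    using bij_betw_parity_bipartitions[of True] by (auto simp: bij_betw_def)
  then show ?thesis
    using solutions[of False] solutions[of True] classes even_bipartitions_trivial_or_power2
      card_parity_sets_True
    by (simp add: parity_bipartitions_simps parity_tensor_simps card_parity_bipartitions)
qed

end
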